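(* Let $k\in\mathbb N$ and let $n_1,\dots,n_k$ be positive integers. Let $(C_i)_{i=1}^k$ and $(D_i)_{i=1}^k$ be two sequences of positive matrices such that for each $i\in\{1,2,\dots,k\}$ the matrices $C_i$ and $D_i$ are of format $n_i\times n_i$. Let $C$ be a positive matrix of format $(n_1+\cdots+n_k)\times(n_1+\cdots+n_k)$ such that the diagonal blocks of $C^{-1}$ (with respect to the partition $n_1,\dots,n_k$) are $C_1^{-1},\dots,C_k^{-1}$. Then $$\frac{\det\left(C+\operatorname{diag}(D_1,\dots,D_k)\right)}{\det C}\leq \frac{\det(C_1+D_1)}{\det C_1}\cdots\frac{\det(C_k+D_k)}{\det C_k}.$$
   Context: All matrices have complex entries. A square matrix $A$ of format $n\times n$ is called positive if it is self-adjoint ($A^*=A$, where $A^*$ is the conjugate transpose) and $\langle Ax,x\rangle>0$ for every non-zero $x\in\mathbb C^n$, where $\langle u,v\rangle=\sum_i u_i\overline{v_i}$. For square matrices $B_1,\dots,B_k$ of formats $n_1\times n_1,\dots,n_k\times n_k$, $\operatorname{diag}(B_1,\dots,B_k)$ denotes the $(n_1+\cdots+n_k)\times(n_1+\cdots+n_k)$ block-diagonal matrix whose main diagonal blocks are $B_1,\dots,B_k$ and all of whose other entries are $0$. The off-diagonal blocks of $C^{-1}$ are otherwise arbitrary. *)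

theory Defs
  imports
    "Jordan_Normal_Form.Schur_Decomposition"
    "Jordan_Normal_Form.Gauss_Jordan_Elimination"
begin

text \<open>
  The order on \<^typ>\<open>complex\<close> is the one of Complex_Order: \<open>z < w\<close> holds iff
  \<open>Re z < Re w\<close> and \<open>Im z = Im w\<close>.  So \<open>0 < z\<close> says that \<open>z\<close> is a positive real.
  The product \<open>u \<bullet>c v\<close> is \<open>\<Sum>i. u\<^sub>i * cnj v\<^sub>i\<close>.
\<close>

definition positive_mat :: "complex mat \<Rightarrow> bool" where
  "positive_mat A \<longleftrightarrow> square_mat A \<and> mat_adjoint A = A \<and>
     (\<forall>x \<in> carrier_vec (dim_row A). x \<noteq> 0\<^sub>v (dim_row A) \<longrightarrow> (A *\<^sub>v x) \<bullet>c x > 0)"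

text \<open>
  Blocks are numbered from 1, matrix entries from 0, so the \<open>i\<close>-th diagonal block with respect to
  the partition \<open>n 1, n 2, \<dots>\<close> starts at position \<open>n 1 + \<dots> + n (i - 1)\<close>.
\<close>

definition diagonal_block :: "(nat \<Rightarrow> nat) \<Rightarrow> nat \<Rightarrow> 'a mat \<Rightarrow> 'a mat" where
  "diagonal_block n i A =
     (let s = (\<Sum>j = 1..<i. n j) in mat (n i) (n i) (\<lambda>(r, c). A $$ (s + r, s + c)))"

text \<open>
  Positive matrices are invertible, so on them the option returned by \<^const>\<open>mat_inverse\<close> is
  never \<^const>\<open>None\<close> and \<open>the (mat_inverse A)\<close> is the inverse of \<open>A\<close>.
\<close>

lemma positive_mat_inverse:
  assumes A: "A \<in> carrier_mat n n" and pos: "positive_mat A"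
  shows "the (mat_inverse A) \<in> carrier_mat n n"
    and "A * the (mat_inverse A) = 1\<^sub>m n"
    and "the (mat_inverse A) * A = 1\<^sub>m n"
proof -
  have "det A \<noteq> 0"
  proof
    assume "det A = 0"
    then obtain v where v: "v \<in> carrier_vec n" "v \<noteq> 0\<^sub>v n" "A *\<^sub>v v = 0\<^sub>v n"
      using det_0_iff_vec_prod_zero[OF A] by auto
    then have "(A *\<^sub>v v) \<bullet>c v > 0" using pos A unfolding positive_mat_def by auto
    then show False using v by simp
  qed
  then have "A \<in> Units (ring_mat TYPE(complex) n ())"
    by (rule det_non_zero_imp_unit[OF A])
  then obtain B where B: "mat_inverse A = Some B"
    using mat_inverse(1)[OF A, of "()"] by (cases "mat_inverse A") auto
  show "the (mat_inverse A) \<in> carrier_mat n n"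
    and "A * the (mat_inverse A) = 1\<^sub>m n"
    and "the (mat_inverse A) * A = 1\<^sub>m n"
    using mat_inverse(2)[OF A B] B by auto
qed

end

theory Submission
  imports Defs
begin

text \<open>
  Write \<open>P = C\<^sup>-\<^sup>1\<close> and \<open>D = diag(D\<^sub>1, \<dots>, D\<^sub>k)\<close>, and let \<open>P\<^sub>i = C\<^sub>i\<^sup>-\<^sup>1\<close> be the diagonal blocks of \<open>P\<close>.
  Dividing by \<open>det C\<close> and \<open>det C\<^sub>i\<close> turns the claim into one that involves \<open>C\<close> only through \<open>P\<close>
  (lemma \<open>det_add_over_det\<close>):
  \<open>det (1 + P D) \<le> det (1 + P\<^sub>1 D\<^sub>1) \<cdots> det (1 + P\<^sub>k D\<^sub>k)\<close>.
  Since \<open>1 + P D = (D\<^sup>-\<^sup>1 + P) D\<close> and \<open>D\<close> is block diagonal, the factors \<open>det D\<^sub>i\<close> cancel, and what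
  is left is Fischer's inequality for the positive matrix \<open>D\<^sup>-\<^sup>1 + P\<close>: its determinant is at most
  the product of the determinants of its diagonal blocks \<open>D\<^sub>i\<^sup>-\<^sup>1 + P\<^sub>i\<close>.  It is enough to treat two
  blocks (\<open>det_one_plus_four_block_le\<close>); an induction on \<open>k\<close> that splits off the last block does
  the rest (\<open>det_one_plus_diag_block_le\<close>).

  Fischer's inequality comes from Hadamard's, \<open>det A \<le> \<Prod>\<^sub>i a\<^sub>i\<^sub>i\<close>.  A congruence \<open>A \<mapsto> V A V\<^sup>*\<close> with
  \<open>det V = 1\<close> preserves positivity and the determinant, and some such congruence makes a given
  positive matrix diagonal.  Applying one to each diagonal block of \<open>M\<close> gives a positive matrix
  with the determinant of \<open>M\<close> whose diagonal entries have the product of the block determinants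
  as their product, and Hadamard's inequality bounds the determinant by that product.

  Both the diagonalization and Hadamard's inequality rest on one step of block elimination
  (\<open>positive_mat_block_elimination\<close>), which replaces the last diagonal block by its Schur
  complement; that is smaller than the block by a term of the form \<open>R A R\<^sup>*\<close>.
\<close>


section \<open>Adjoints and quadratic forms\<close>

lemma dim_mat_adjoint [simp]:
  "dim_row (mat_adjoint A) = dim_col A" "dim_col (mat_adjoint A) = dim_row A"
  by (auto simp: mat_adjoint_def)

lemma mat_adjoint_carrier [simp]:
  "A \<in> carrier_mat m n \<Longrightarrow> mat_adjoint A \<in> carrier_mat n m"
  by (rule carrier_matI) simp_all

lemma index_mat_adjoint [simp]:
  "i < dim_col A \<Longrightarrow> j < dim_row A \<Longrightarrow> mat_adjoint A $$ (i, j) = conjugate (A $$ (j, i))"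
  by (auto simp: mat_adjoint_def mat_of_rows_index)

lemma mat_adjoint_adjoint [simp]: "mat_adjoint (mat_adjoint A) = A"
  by (intro eq_matI) auto

lemma mat_adjoint_one [simp]: "mat_adjoint (1\<^sub>m n :: complex mat) = 1\<^sub>m n"
  by (intro eq_matI) auto

lemma mat_adjoint_zero [simp]: "mat_adjoint (0\<^sub>m m n :: complex mat) = 0\<^sub>m n m"
  by (intro eq_matI) auto

lemma mat_adjoint_uminus: "mat_adjoint (- A :: complex mat) = - mat_adjoint A"
  by (intro eq_matI) auto

lemma mat_adjoint_add:
  assumes "A \<in> carrier_mat m n" "B \<in> carrier_mat m n"
  shows "mat_adjoint (A + B :: complex mat) = mat_adjoint A + mat_adjoint B"
  by (rule eq_matI) (simp_all add: carrier_matD[OF assms(1)] carrier_matD[OF assms(2)])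

lemma mat_adjoint_mult:
  fixes A B :: "complex mat"
  assumes "A \<in> carrier_mat l m" "B \<in> carrier_mat m n"
  shows "mat_adjoint (A * B) = mat_adjoint B * mat_adjoint A"
  using assms by (intro eq_matI) (auto simp: scalar_prod_def mult.commute)

lemma mat_adjoint_four_block:
  fixes A B C D :: "complex mat"
  assumes "A \<in> carrier_mat n n" "B \<in> carrier_mat n m" "C \<in> carrier_mat m n" "D \<in> carrier_mat m m"
  shows "mat_adjoint (four_block_mat A B C D)
    = four_block_mat (mat_adjoint A) (mat_adjoint C) (mat_adjoint B) (mat_adjoint D)"
  using assms by (intro eq_matI) auto

lemma det_mat_adjoint:
  assumes "A \<in> carrier_mat n n"
  shows "det (mat_adjoint A) = cnj (det A)"
proof -
  interpret cnj: comm_ring_hom cnj by standard auto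
  have "mat_adjoint A = map_mat cnj (transpose_mat A)"
    using assms by (intro eq_matI) auto
  then show ?thesis
    using det_transpose[OF assms] by simp
qed

lemma cscalar_prod_mat_adjoint:
  fixes A :: "complex mat"
  assumes "A \<in> carrier_mat m n" "u \<in> carrier_vec n" "x \<in> carrier_vec m"
  shows "(A *\<^sub>v u) \<bullet>c x = u \<bullet>c (mat_adjoint A *\<^sub>v x)"
proof -
  have "conjugate (mat_adjoint A *\<^sub>v x) = transpose_mat A *\<^sub>v conjugate x"
    using assms by (intro eq_vecI) (auto simp: scalar_prod_def)
  moreover have "(transpose_mat A *\<^sub>v conjugate x) \<bullet> u = conjugate x \<bullet> (A *\<^sub>v u)"
    by (rule transpose_vec_mult_scalar) (use assms in auto)
  ultimately show ?thesis
    using assms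
      comm_scalar_prod[of "A *\<^sub>v u" m "conjugate x"]
      comm_scalar_prod[of u n "transpose_mat A *\<^sub>v conjugate x"]
    by auto
qed

lemma mult_mat_zero_vec:
  "A \<in> carrier_mat m n \<Longrightarrow> A *\<^sub>v 0\<^sub>v n = (0\<^sub>v m :: complex vec)"
  by (rule eq_vecI) auto

lemma quadratic_form_four_block:
  fixes A B C D :: "complex mat"
  assumes "A \<in> carrier_mat n n" "B \<in> carrier_mat n m" "C \<in> carrier_mat m n" "D \<in> carrier_mat m m"
    and "x \<in> carrier_vec n" "y \<in> carrier_vec m"
  shows "(four_block_mat A B C D *\<^sub>v (x @\<^sub>v y)) \<bullet>c (x @\<^sub>v y)
    = (A *\<^sub>v x + B *\<^sub>v y) \<bullet>c x + (C *\<^sub>v x + D *\<^sub>v y) \<bullet>c y"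
proof -
  have "conjugate (x @\<^sub>v y) = conjugate x @\<^sub>v conjugate y"
    using assms by (intro eq_vecI) auto
  moreover have "A *\<^sub>v x + B *\<^sub>v y \<in> carrier_vec n" "C *\<^sub>v x + D *\<^sub>v y \<in> carrier_vec m"
    using assms by (auto intro!: add_carrier_vec mult_mat_vec_carrier)
  ultimately show ?thesis
    using four_block_mat_mult_vec[OF assms]
      scalar_prod_append[of "A *\<^sub>v x + B *\<^sub>v y" n "C *\<^sub>v x + D *\<^sub>v y" m "conjugate x" "conjugate y"]
      assms(5,6)
    by simp
qed

lemma congruence_carrier:
  fixes A :: "complex mat"
  assumes "A \<in> carrier_mat n n" "R \<in> carrier_mat m n"
  shows "R * A * mat_adjoint R \<in> carrier_mat m m"
  using assms by (intro mult_carrier_mat mat_adjoint_carrier)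

text \<open>
  Congruence with \<open>R\<close> is the substitution \<open>y = R\<^sup>* x\<close> in the quadratic form.  This is why it
  preserves positivity.
\<close>

lemma quadratic_form_congruence:
  fixes A R :: "complex mat"
  assumes "A \<in> carrier_mat n n" "R \<in> carrier_mat m n" "x \<in> carrier_vec m"
  shows "((R * A * mat_adjoint R) *\<^sub>v x) \<bullet>c x
    = (A *\<^sub>v (mat_adjoint R *\<^sub>v x)) \<bullet>c (mat_adjoint R *\<^sub>v x)"
proof -
  have "(R * A * mat_adjoint R) *\<^sub>v x = R *\<^sub>v (A *\<^sub>v (mat_adjoint R *\<^sub>v x))"
    using assms
    by (simp add: assoc_mult_mat_vec[of "R * A" m n _ m] assoc_mult_mat_vec[of R m n A n]
        mult_mat_vec_carrier[of _ n m])
  then show ?thesis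
    using assms cscalar_prod_mat_adjoint[of R m n "A *\<^sub>v (mat_adjoint R *\<^sub>v x)" x]
    by (simp add: mult_mat_vec_carrier[of _ n n] mult_mat_vec_carrier[of _ n m])
qed

lemma quadratic_form_unit_vec:
  fixes A :: "complex mat"
  assumes "A \<in> carrier_mat n n" "i < n"
  shows "(A *\<^sub>v unit_vec n i) \<bullet>c unit_vec n i = A $$ (i, i)"
proof -
  have "conjugate (unit_vec n i :: complex vec) = unit_vec n i"
    by (rule eq_vecI) (simp_all add: unit_vec_def)
  moreover have "A *\<^sub>v unit_vec n i \<in> carrier_vec n"
    using assms(1) by (rule mult_mat_vec_carrier) simp
  moreover have "(A *\<^sub>v unit_vec n i) $ i = A $$ (i, i)"
    using assms by simp
  ultimately show ?thesis using assms(2) by simp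
qed


section \<open>Positive matrices\<close>

lemma positive_matI:
  assumes "A \<in> carrier_mat n n" "mat_adjoint A = A"
    and "\<And>x. x \<in> carrier_vec n \<Longrightarrow> x \<noteq> 0\<^sub>v n \<Longrightarrow> (A *\<^sub>v x) \<bullet>c x > 0"
  shows "positive_mat A"
  using assms by (auto simp: positive_mat_def)

lemma positive_matD:
  assumes "positive_mat A" "A \<in> carrier_mat n n"
  shows "mat_adjoint A = A"
    and "x \<in> carrier_vec n \<Longrightarrow> x \<noteq> 0\<^sub>v n \<Longrightarrow> (A *\<^sub>v x) \<bullet>c x > 0"
    and "x \<in> carrier_vec n \<Longrightarrow> (A *\<^sub>v x) \<bullet>c x \<ge> 0"
proof -
  show adj: "mat_adjoint A = A"
    and pos: "x \<in> carrier_vec n \<Longrightarrow> x \<noteq> 0\<^sub>v n \<Longrightarrow> (A *\<^sub>v x) \<bullet>c x > 0"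
    using assms by (auto simp: positive_mat_def)
  show "(A *\<^sub>v x) \<bullet>c x \<ge> 0" if "x \<in> carrier_vec n"
  proof (cases "x = 0\<^sub>v n")
    case True
    then show ?thesis using mult_mat_zero_vec[OF assms(2)] by simp
  next
    case False
    then show ?thesis using pos that by (blast intro: less_imp_le)
  qed
qed

lemma positive_mat_diag_pos:
  assumes "positive_mat A" "A \<in> carrier_mat n n" "i < n"
  shows "A $$ (i, i) > 0"
  using positive_matD(2)[OF assms(1,2) unit_vec_carrier unit_vec_nonzero[OF assms(3)]]
  unfolding quadratic_form_unit_vec[OF assms(2,3)] .

lemma positive_mat_add:
  assumes "positive_mat A" "positive_mat B" "A \<in> carrier_mat n n" "B \<in> carrier_mat n n"
  shows "positive_mat (A + B)"
proof (rule positive_matI)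
  show "A + B \<in> carrier_mat n n" using assms(3,4) by simp
  show "mat_adjoint (A + B) = A + B"
    using mat_adjoint_add[OF assms(3,4)] positive_matD(1)[OF assms(1,3)] positive_matD(1)[OF assms(2,4)]
    by simp
  fix x :: "complex vec"
  assume x: "x \<in> carrier_vec n" "x \<noteq> 0\<^sub>v n"
  have "((A + B) *\<^sub>v x) \<bullet>c x = (A *\<^sub>v x) \<bullet>c x + (B *\<^sub>v x) \<bullet>c x"
    using add_mult_distrib_mat_vec[OF assms(3,4) x(1)]
      add_scalar_prod_distrib[of "A *\<^sub>v x" n "B *\<^sub>v x" "conjugate x"]
      mult_mat_vec_carrier[OF assms(3) x(1)] mult_mat_vec_carrier[OF assms(4) x(1)] x(1)
    by simp
  then show "((A + B) *\<^sub>v x) \<bullet>c x > 0"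
    using positive_matD(2)[OF assms(1,3) x] positive_matD(2)[OF assms(2,4) x]
    by (simp add: add_pos_pos)
qed

lemma positive_mat_congruence:
  assumes "positive_mat A" "A \<in> carrier_mat n n" "V \<in> carrier_mat n n" "det V \<noteq> 0"
  shows "positive_mat (V * A * mat_adjoint V)"
proof (rule positive_matI)
  show "V * A * mat_adjoint V \<in> carrier_mat n n"
    by (rule congruence_carrier[OF assms(2,3)])
  have "mat_adjoint (V * A * mat_adjoint V) = V * (A * mat_adjoint V)"
    using mat_adjoint_mult[of "V * A" n n "mat_adjoint V" n] mat_adjoint_mult[OF assms(3,2)]
      assms(2,3) positive_matD(1)[OF assms(1,2)] by simp
  then show "mat_adjoint (V * A * mat_adjoint V) = V * A * mat_adjoint V"
    using assoc_mult_mat[OF assms(3,2) mat_adjoint_carrier[OF assms(3)]] by simp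
  fix x :: "complex vec"
  assume x: "x \<in> carrier_vec n" "x \<noteq> 0\<^sub>v n"
  have "det (mat_adjoint V) \<noteq> 0"
    using assms(3,4) by (simp add: det_mat_adjoint)
  then have "mat_adjoint V *\<^sub>v x \<noteq> 0\<^sub>v n"
    using x assms(3) det_0_iff_vec_prod_zero[of "mat_adjoint V" n] by auto
  then show "((V * A * mat_adjoint V) *\<^sub>v x) \<bullet>c x > 0"
    using positive_matD(2)[OF assms(1,2), of "mat_adjoint V *\<^sub>v x"]
      quadratic_form_congruence[OF assms(2,3) x(1)]
      mult_mat_vec_carrier[OF mat_adjoint_carrier[OF assms(3)] x(1)]
    by simp
qed

text \<open>
  From \<open>B A = 1\<close> one gets \<open>B A B\<^sup>* = B\<^sup>*\<close>, so \<open>B\<^sup>*\<close> is congruent to \<open>A\<close> and hence positive; being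
  self-adjoint, it equals \<open>B\<close>.
\<close>

lemma positive_mat_right_inverse:
  assumes "positive_mat A" "A \<in> carrier_mat n n" "B \<in> carrier_mat n n" "A * B = 1\<^sub>m n"
  shows "positive_mat B"
proof -
  have BA: "B * A = 1\<^sub>m n"
    using mat_mult_left_right_inverse[OF assms(2-4)] .
  have "det B * det A = 1"
    using det_mult[OF assms(3,2)] BA by simp
  then have "det B \<noteq> 0" by auto
  then have pos: "positive_mat (B * A * mat_adjoint B)"
    using assms by (intro positive_mat_congruence)
  have eq: "B * A * mat_adjoint B = mat_adjoint B"
    using BA assms(3) by simp
  have "mat_adjoint B = B"
    using positive_matD(1)[OF pos, of n] assms(3) unfolding eq by simp
  then show ?thesis using pos eq by simp
qed

lemma append_zero_vec: "0\<^sub>v n @\<^sub>v 0\<^sub>v m = (0\<^sub>v (n + m) :: complex vec)"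
  by (rule eq_vecI) auto

lemma positive_mat_four_block_diag:
  assumes A: "A \<in> carrier_mat n n" "positive_mat A" and E: "E \<in> carrier_mat m m" "positive_mat E"
  shows "positive_mat (four_block_mat A (0\<^sub>m n m) (0\<^sub>m m n) E)"
proof (rule positive_matI)
  let ?M = "four_block_mat A (0\<^sub>m n m) (0\<^sub>m m n) E"
  show "?M \<in> carrier_mat (n + m) (n + m)"
    using A(1) E(1) by (rule four_block_carrier_mat)
  show "mat_adjoint ?M = ?M"
    using mat_adjoint_four_block[OF A(1) _ _ E(1), of "0\<^sub>m n m" "0\<^sub>m m n"]
      positive_matD(1)[OF A(2,1)] positive_matD(1)[OF E(2,1)] by simp
  fix z :: "complex vec"
  assume z: "z \<in> carrier_vec (n + m)" "z \<noteq> 0\<^sub>v (n + m)"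
  define x y where "x = vec_first z n" and "y = vec_last z m"
  have xy: "x \<in> carrier_vec n" "y \<in> carrier_vec m" "z = x @\<^sub>v y"
    using z(1) by (auto simp: x_def y_def)
  have "0\<^sub>m n m *\<^sub>v y = 0\<^sub>v n" "0\<^sub>m m n *\<^sub>v x = 0\<^sub>v m"
    using xy by (auto intro!: eq_vecI)
  then have form: "(?M *\<^sub>v z) \<bullet>c z = (A *\<^sub>v x) \<bullet>c x + (E *\<^sub>v y) \<bullet>c y"
    using quadratic_form_four_block[OF A(1) _ _ E(1) xy(1,2), of "0\<^sub>m n m" "0\<^sub>m m n"]
      mult_mat_vec_carrier[OF A(1) xy(1)] mult_mat_vec_carrier[OF E(1) xy(2)] xy(3)
    by simp
  show "(?M *\<^sub>v z) \<bullet>c z > 0"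
  proof (cases "x = 0\<^sub>v n")
    case True
    then have "y \<noteq> 0\<^sub>v m" using z(2) xy(3) append_zero_vec by auto
    then show ?thesis
      unfolding form using positive_matD(3)[OF A(2,1) xy(1)] positive_matD(2)[OF E(2,1) xy(2)]
      by (simp add: add_nonneg_pos)
  next
    case False
    then show ?thesis
      unfolding form using positive_matD(2)[OF A(2,1) xy(1)] positive_matD(3)[OF E(2,1) xy(2)]
      by (simp add: add_pos_nonneg)
  qed
qed

text \<open>
  A diagonal block inherits positivity because its quadratic form is that of the whole matrix,
  restricted to vectors that vanish on the other block.
\<close>

lemma positive_mat_four_block:
  assumes pos: "positive_mat (four_block_mat A B B' E)"
    and A: "A \<in> carrier_mat n n" and B: "B \<in> carrier_mat n m"
    and B': "B' \<in> carrier_mat m n" and E: "E \<in> carrier_mat m m"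
  shows "positive_mat A" "positive_mat E" "B' = mat_adjoint B"
proof -
  let ?M = "four_block_mat A B B' E"
  have M: "?M \<in> carrier_mat (n + m) (n + m)"
    using A E by (rule four_block_carrier_mat)
  have entry: "four_block_mat (mat_adjoint A) (mat_adjoint B') (mat_adjoint B) (mat_adjoint E) $$ (i, j)
      = ?M $$ (i, j)" for i j
    using positive_matD(1)[OF pos M] mat_adjoint_four_block[OF A B B' E] by simp
  note dims = carrier_matD[OF A] carrier_matD[OF B] carrier_matD[OF B'] carrier_matD[OF E]
  show "positive_mat A"
  proof (rule positive_matI[OF A])
    show "mat_adjoint A = A"
    proof (rule eq_matI)
      fix i j assume "i < dim_row A" "j < dim_col A"
      then show "mat_adjoint A $$ (i, j) = A $$ (i, j)" using entry[of i j] dims by simp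
    qed (simp_all add: dims)
    fix x :: "complex vec" assume x: "x \<in> carrier_vec n" "x \<noteq> 0\<^sub>v n"
    then have "x @\<^sub>v 0\<^sub>v m \<in> carrier_vec (n + m)" "x @\<^sub>v 0\<^sub>v m \<noteq> 0\<^sub>v (n + m)"
      using append_vec_eq[OF x(1) zero_carrier_vec, of "0\<^sub>v m" "0\<^sub>v m"]
      by (simp_all flip: append_zero_vec)
    from positive_matD(2)[OF pos M this] show "(A *\<^sub>v x) \<bullet>c x > 0"
      using mult_mat_vec_carrier[OF A x(1)] mult_mat_vec_carrier[OF B' x(1)] x(1)
      by (simp add: quadratic_form_four_block[OF A B B' E x(1)] mult_mat_zero_vec[OF B]
          mult_mat_zero_vec[OF E])
  qed
  show "positive_mat E"
  proof (rule positive_matI[OF E])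
    show "mat_adjoint E = E"
    proof (rule eq_matI)
      fix i j assume "i < dim_row E" "j < dim_col E"
      then show "mat_adjoint E $$ (i, j) = E $$ (i, j)" using entry[of "n + i" "n + j"] dims by simp
    qed (simp_all add: dims)
    fix x :: "complex vec" assume x: "x \<in> carrier_vec m" "x \<noteq> 0\<^sub>v m"
    then have "0\<^sub>v n @\<^sub>v x \<in> carrier_vec (n + m)" "0\<^sub>v n @\<^sub>v x \<noteq> 0\<^sub>v (n + m)"
      using append_vec_eq[of "0\<^sub>v n" n "0\<^sub>v n" x "0\<^sub>v m"]
      by (simp_all flip: append_zero_vec)
    from positive_matD(2)[OF pos M this] show "(E *\<^sub>v x) \<bullet>c x > 0"
      using mult_mat_vec_carrier[OF B x(1)] mult_mat_vec_carrier[OF E x(1)] x(1)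
      by (simp add: quadratic_form_four_block[OF A B B' E _ x(1)] mult_mat_zero_vec[OF A]
          mult_mat_zero_vec[OF B'])
  qed
  show "B' = mat_adjoint B"
  proof (rule eq_matI)
    fix i j assume "i < dim_row (mat_adjoint B)" "j < dim_col (mat_adjoint B)"
    then show "B' $$ (i, j) = mat_adjoint B $$ (i, j)" using entry[of "n + i" j] dims by simp
  qed (simp_all add: dims)
qed


section \<open>Block elimination, Hadamard's and Fischer's inequalities\<close>

text \<open>
  With \<open>R = - B' A\<^sup>-\<^sup>1\<close> and \<open>W\<close> lower block triangular with unit diagonal blocks and \<open>R\<close> in the corner,
  left multiplication by \<open>W\<close> clears the lower left block and, as the matrix is self-adjoint, right
  multiplication by \<open>W\<^sup>*\<close> clears the upper right one.  The new last block \<open>S = E - B' A\<^sup>-\<^sup>1 B\<close> is the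
  Schur complement of \<open>A\<close>.  The form \<open>E = S + R A R\<^sup>*\<close> shows that the subtracted matrix is
  positive semidefinite.
\<close>

lemma positive_mat_block_elimination:
  assumes pos: "positive_mat (four_block_mat A B B' E)"
    and A: "A \<in> carrier_mat n n" and B: "B \<in> carrier_mat n m"
    and B': "B' \<in> carrier_mat m n" and E: "E \<in> carrier_mat m m"
  obtains W R S where "W \<in> carrier_mat (n + m) (n + m)" "det W = 1"
    "R \<in> carrier_mat m n" "S \<in> carrier_mat m m"
    "W * four_block_mat A B B' E * mat_adjoint W = four_block_mat A (0\<^sub>m n m) (0\<^sub>m m n) S"
    "E = S + R * A * mat_adjoint R"
proof -
  note posA = positive_mat_four_block(1)[OF assms] and adjB = positive_mat_four_block(3)[OF assms]
  define A' where "A' = the (mat_inverse A)"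
  have A': "A' \<in> carrier_mat n n" "A' * A = 1\<^sub>m n"
    using positive_mat_inverse[OF A posA] by (simp_all add: A'_def)
  define R where "R = - (B' * A')"
  have R: "R \<in> carrier_mat m n" using B' A'(1) by (simp add: R_def)
  have R': "mat_adjoint R \<in> carrier_mat n m" using R by simp
  have B'A': "B' * A' \<in> carrier_mat m n" using B' A'(1) by simp
  have RA: "R * A = - B'"
    using A B' A' B'A' assoc_mult_mat[OF B' A'(1) A] by (simp add: R_def)
  have AR: "A * mat_adjoint R = - B"
    using mat_adjoint_mult[OF R A] positive_matD(1)[OF posA A] mat_adjoint_uminus[of B'] adjB
    by (simp add: RA)
  define S where "S = R * B + E"
  have RB: "R * B \<in> carrier_mat m m" using R B by simp
  have S: "S \<in> carrier_mat m m" using RB E by (simp add: S_def)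
  define W where "W = four_block_mat (1\<^sub>m n) (0\<^sub>m n m) R (1\<^sub>m m)"
  have W: "W \<in> carrier_mat (n + m) (n + m)" by (simp add: W_def)
  have "det W = 1"
    using det_four_block_mat_upper_right_zero[OF one_carrier_mat refl R one_carrier_mat]
    by (simp add: W_def)
  moreover have "W * four_block_mat A B B' E = four_block_mat A B (0\<^sub>m m n) S"
    unfolding W_def using A B B' E RB
    by (subst mult_four_block_mat[OF one_carrier_mat zero_carrier_mat R one_carrier_mat A B B' E])
      (simp add: RA S_def)
  moreover have "mat_adjoint W = four_block_mat (1\<^sub>m n) (mat_adjoint R) (0\<^sub>m m n) (1\<^sub>m m)"
    unfolding W_def
    using mat_adjoint_four_block[OF one_carrier_mat zero_carrier_mat R one_carrier_mat] by simp
  moreover have "four_block_mat A B (0\<^sub>m m n) S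
      * four_block_mat (1\<^sub>m n) (mat_adjoint R) (0\<^sub>m m n) (1\<^sub>m m)
      = four_block_mat A (0\<^sub>m n m) (0\<^sub>m m n) S"
    using A B S
    by (subst mult_four_block_mat[OF A B zero_carrier_mat S one_carrier_mat R' zero_carrier_mat
          one_carrier_mat]) (simp add: AR left_mult_zero_mat[OF R'])
  moreover have "E = S + R * A * mat_adjoint R"
  proof -
    have "R * A * mat_adjoint R = - (R * B)"
      using assoc_mult_mat[OF R A R'] R B by (simp add: AR)
    moreover have "R * B + E + - (R * B) = E"
      using R B E by (intro eq_matI) auto
    ultimately show ?thesis by (simp add: S_def)
  qed
  ultimately show thesis using that[OF W _ R S] by simp
qed

lemma det_unimodular_congruence:
  fixes A V :: "complex mat"
  assumes "A \<in> carrier_mat n n" "V \<in> carrier_mat n n" "det V = 1"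
  shows "det (V * A * mat_adjoint V) = det A"
  using det_mult[of "V * A" n "mat_adjoint V"] det_mult[OF assms(2,1)] assms
  by (simp add: det_mat_adjoint[OF assms(2)])

lemma det_diagonal_mat:
  assumes "A \<in> carrier_mat n n" "diagonal_mat A"
  shows "det A = prod_list (diag_mat A)"
  using assms by (intro det_upper_triangular[of A n]) (auto simp: diagonal_mat_def)

lemma congruence_mult:
  fixes A :: "complex mat"
  assumes A: "A \<in> carrier_mat n n" and V: "V \<in> carrier_mat n n" and W: "W \<in> carrier_mat n n"
  shows "V * W * A * mat_adjoint (V * W) = V * (W * A * mat_adjoint W) * mat_adjoint V"
proof -
  note V' = mat_adjoint_carrier[OF V] and W' = mat_adjoint_carrier[OF W]
  note WA = mult_carrier_mat[OF W A]
  show ?thesis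
    unfolding mat_adjoint_mult[OF V W] assoc_mult_mat[OF V W A]
    unfolding assoc_mult_mat[OF V WA mult_carrier_mat[OF W' V']]
      assoc_mult_mat[OF V mult_carrier_mat[OF WA W'] V'] assoc_mult_mat[OF WA W' V'] ..
qed

lemma congruence_four_block:
  fixes A B C D :: "complex mat"
  assumes A: "A \<in> carrier_mat n n" and B: "B \<in> carrier_mat n m"
    and C: "C \<in> carrier_mat m n" and D: "D \<in> carrier_mat m m"
    and U: "U \<in> carrier_mat n n" and V: "V \<in> carrier_mat m m"
  defines "F \<equiv> four_block_mat U (0\<^sub>m n m) (0\<^sub>m m n) V"
  shows "F \<in> carrier_mat (n + m) (n + m)" "det F = det U * det V"
    "F * four_block_mat A B C D * mat_adjoint F = four_block_mat (U * A * mat_adjoint U)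
      (U * B * mat_adjoint V) (V * C * mat_adjoint U) (V * D * mat_adjoint V)"
proof -
  show "F \<in> carrier_mat (n + m) (n + m)"
    unfolding F_def using U V by (rule four_block_carrier_mat)
  show "det F = det U * det V"
    unfolding F_def by (rule det_four_block_mat_upper_right_zero[OF U refl zero_carrier_mat V])
  have c: "U * A \<in> carrier_mat n n" "U * B \<in> carrier_mat n m" "V * C \<in> carrier_mat m n"
    "V * D \<in> carrier_mat m m" "mat_adjoint U \<in> carrier_mat n n" "mat_adjoint V \<in> carrier_mat m m"
    using U V A B C D by simp_all
  have "mat_adjoint F = four_block_mat (mat_adjoint U) (0\<^sub>m n m) (0\<^sub>m m n) (mat_adjoint V)"
    unfolding F_def using mat_adjoint_four_block[OF U zero_carrier_mat zero_carrier_mat V] by simp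
  moreover have "F * four_block_mat A B C D = four_block_mat (U * A) (U * B) (V * C) (V * D)"
    unfolding F_def using U V A B C D
    by (subst mult_four_block_mat[OF U zero_carrier_mat zero_carrier_mat V A B C D]) simp
  moreover have "four_block_mat (U * A) (U * B) (V * C) (V * D)
      * four_block_mat (mat_adjoint U) (0\<^sub>m n m) (0\<^sub>m m n) (mat_adjoint V)
    = four_block_mat (U * A * mat_adjoint U) (U * B * mat_adjoint V)
      (V * C * mat_adjoint U) (V * D * mat_adjoint V)"
    using c
    by (subst mult_four_block_mat[OF c(1-5) zero_carrier_mat zero_carrier_mat c(6)])
      (simp add: right_mult_zero_mat[OF c(1)] right_mult_zero_mat[OF c(2)]
        right_mult_zero_mat[OF c(3)] right_mult_zero_mat[OF c(4)])
  ultimately show "F * four_block_mat A B C D * mat_adjoint F = four_block_mat (U * A * mat_adjoint U)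
      (U * B * mat_adjoint V) (V * C * mat_adjoint U) (V * D * mat_adjoint V)"
    by simp
qed

lemma mat_four_block_cases:
  assumes "M \<in> carrier_mat (n + m) (n + m)"
  obtains A B C D where "A \<in> carrier_mat n n" "B \<in> carrier_mat n m" "C \<in> carrier_mat m n"
    "D \<in> carrier_mat m m" "M = four_block_mat A B C D"
proof -
  obtain A B C D where s: "split_block M n n = (A, B, C, D)"
    by (metis surj_pair)
  show thesis
    using split_block[OF s, of m m] assms that by auto
qed

text \<open>
  One elimination step isolates the last row and column, and the induction hypothesis
  diagonalizes the remaining leading block.  As \<open>V\<close> has to have determinant 1 but
  need not be unitary, elimination can produce it, without any eigenvalues.
\<close>

lemma positive_mat_unimodular_diagonalization:
  assumes "A \<in> carrier_mat n n" "positive_mat A"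
  obtains V where "V \<in> carrier_mat n n" "det V = 1" "diagonal_mat (V * A * mat_adjoint V)"
proof -
  have "\<exists>V \<in> carrier_mat n n. det V = 1 \<and> diagonal_mat (V * A * mat_adjoint V)"
    using assms
  proof (induction n arbitrary: A)
    case 0
    then show ?case by (intro bexI[of _ "1\<^sub>m 0"]) (auto simp: diagonal_mat_def)
  next
    case (Suc n)
    have A: "A \<in> carrier_mat (n + 1) (n + 1)" using Suc.prems(1) by simp
    obtain B C C' E where bl: "B \<in> carrier_mat n n" "C \<in> carrier_mat n 1" "C' \<in> carrier_mat 1 n"
      "E \<in> carrier_mat 1 1" "A = four_block_mat B C C' E"
      using mat_four_block_cases[OF A] .
    have pos: "positive_mat (four_block_mat B C C' E)" using Suc.prems(2) bl(5) by simp
    obtain V where V: "V \<in> carrier_mat n n" "det V = 1" "diagonal_mat (V * B * mat_adjoint V)"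
      using Suc.IH[OF bl(1) positive_mat_four_block(1)[OF pos bl(1-4)]] by auto
    obtain W R S where W: "W \<in> carrier_mat (n + 1) (n + 1)" "det W = 1" "S \<in> carrier_mat 1 1"
      "W * A * mat_adjoint W = four_block_mat B (0\<^sub>m n 1) (0\<^sub>m 1 n) S"
      using positive_mat_block_elimination[OF pos bl(1-4)] bl(5) by metis
    define F where "F = four_block_mat V (0\<^sub>m n 1) (0\<^sub>m 1 n) (1\<^sub>m 1)"
    note cF = congruence_four_block[OF bl(1) zero_carrier_mat zero_carrier_mat W(3) V(1)
        one_carrier_mat, folded F_def]
    have zeros: "V * 0\<^sub>m n 1 = 0\<^sub>m n 1" "0\<^sub>m 1 n * mat_adjoint V = 0\<^sub>m 1 n"
      using right_mult_zero_mat[OF V(1)] left_mult_zero_mat[OF mat_adjoint_carrier[OF V(1)]]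
      by auto
    have "det (F * W) = 1"
      using det_mult[OF cF(1) W(1)] cF(2) V(2) W(2) by simp
    moreover have "F * W * A * mat_adjoint (F * W)
        = four_block_mat (V * B * mat_adjoint V) (0\<^sub>m n 1) (0\<^sub>m 1 n) S"
      unfolding congruence_mult[OF A cF(1) W(1)] W(4) cF(3)
      using W(3) zeros by simp
    moreover have "diagonal_mat (four_block_mat (V * B * mat_adjoint V) (0\<^sub>m n 1) (0\<^sub>m 1 n) S)"
      using V(1,3) W(3) by (auto simp: diagonal_mat_def)
    ultimately show ?case
      using cF(1) W(1) by (intro bexI[of _ "F * W"]) auto
  qed
  then show thesis using that by blast
qed

lemma complex_mult_pos: "0 < a \<Longrightarrow> 0 < b \<Longrightarrow> 0 < a * (b :: complex)"
  by (auto simp: less_complex_def)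

lemma complex_prod_list_pos: "(\<And>x. x \<in> set xs \<Longrightarrow> 0 < x) \<Longrightarrow> 0 < prod_list (xs :: complex list)"
  by (induction xs) (auto intro: complex_mult_pos simp: less_complex_def)

lemma positive_mat_det_pos:
  assumes "A \<in> carrier_mat n n" "positive_mat A"
  shows "0 < det A"
proof -
  obtain V where V: "V \<in> carrier_mat n n" "det V = 1" "diagonal_mat (V * A * mat_adjoint V)"
    using positive_mat_unimodular_diagonalization[OF assms] .
  let ?N = "V * A * mat_adjoint V"
  have N: "?N \<in> carrier_mat n n" by (rule congruence_carrier[OF assms(1) V(1)])
  have "positive_mat ?N" using positive_mat_congruence[OF assms(2,1) V(1)] V(2) by simp
  then have "0 < prod_list (diag_mat ?N)"
    using positive_mat_diag_pos[OF _ N] N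
    by (intro complex_prod_list_pos) (auto simp: diag_mat_def)
  then show ?thesis
    using det_diagonal_mat[OF N V(3)] det_unimodular_congruence[OF assms(1) V(1,2)] by simp
qed

text \<open>
  Elimination of the last row and column gives \<open>det A = det B \<cdot> s\<close>, where the scalar Schur complement
  \<open>s\<close> is at most the last diagonal entry of \<open>A\<close>; the rest is induction.
\<close>

lemma Hadamard_inequality:
  assumes "A \<in> carrier_mat n n" "positive_mat A"
  shows "det A \<le> prod_list (diag_mat A)"
  using assms
proof (induction n arbitrary: A)
  case 0
  then show ?case by (simp add: diag_mat_def)
next
  case (Suc n)
  have A: "A \<in> carrier_mat (n + 1) (n + 1)" using Suc.prems(1) by simp
  obtain B C C' E where bl: "B \<in> carrier_mat n n" "C \<in> carrier_mat n 1" "C' \<in> carrier_mat 1 n"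
    "E \<in> carrier_mat 1 1" "A = four_block_mat B C C' E"
    using mat_four_block_cases[OF A] .
  have pos: "positive_mat (four_block_mat B C C' E)" using Suc.prems(2) bl(5) by simp
  note posBE = positive_mat_four_block(1,2)[OF pos bl(1-4)]
  obtain W R S where W: "W \<in> carrier_mat (n + 1) (n + 1)" "det W = 1" "R \<in> carrier_mat 1 n"
    "S \<in> carrier_mat 1 1" "W * A * mat_adjoint W = four_block_mat B (0\<^sub>m n 1) (0\<^sub>m 1 n) S"
    "E = S + R * B * mat_adjoint R"
    using positive_mat_block_elimination[OF pos bl(1-4)] bl(5) by metis
  \<comment> \<open>\<open>R B R\<^sup>*\<close> is a 1 by 1 matrix; its entry is a value of the quadratic form of \<open>B\<close>.\<close>
  have RBR: "R * B * mat_adjoint R \<in> carrier_mat 1 1" by (rule congruence_carrier[OF bl(1) W(3)])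
  have "(R * B * mat_adjoint R) $$ (0, 0)
      = (B *\<^sub>v (mat_adjoint R *\<^sub>v unit_vec 1 0)) \<bullet>c (mat_adjoint R *\<^sub>v unit_vec 1 0)"
    using quadratic_form_unit_vec[OF RBR] quadratic_form_congruence[OF bl(1) W(3)] by simp
  also have "\<dots> \<ge> 0"
    using positive_matD(3)[OF posBE(1) bl(1)] mult_mat_vec_carrier[OF mat_adjoint_carrier[OF W(3)]] by simp
  finally have "S $$ (0, 0) \<le> E $$ (0, 0)"
    using W(3,4,6) bl(1) by simp
  moreover have "det A = det B * S $$ (0, 0)"
    using det_unimodular_congruence[OF A W(1,2)] W(4,5) det_single[OF W(4)]
      det_four_block_mat_upper_right_zero[OF bl(1) refl zero_carrier_mat W(4)] by simp
  ultimately have "det A \<le> det B * E $$ (0, 0)"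
    using positive_mat_det_pos[OF bl(1) posBE(1)] by (simp add: mult_left_mono)
  also have "\<dots> \<le> prod_list (diag_mat B) * E $$ (0, 0)"
    using Suc.IH[OF bl(1) posBE(1)] positive_mat_diag_pos[OF posBE(2) bl(4)]
    by (simp add: mult_right_mono)
  also have "\<dots> = prod_list (diag_mat A)"
    using bl(4) by (simp add: bl(5) diag_four_block_mat[OF bl(1,4)] diag_mat_def[of E])
  finally show ?case .
qed

text \<open>
  The congruence by \<open>F = diag(U, V)\<close>, where \<open>U\<close> and \<open>V\<close> diagonalize \<open>A\<close> and \<open>E\<close>, changes none of the
  three determinants.  Afterwards both diagonal blocks are diagonal, so that the right-hand side
  is a product of diagonal entries and Hadamard's inequality applies.
\<close>

lemma Fischer_inequality:
  assumes pos: "positive_mat (four_block_mat A B B' E)"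
    and A: "A \<in> carrier_mat n n" and B: "B \<in> carrier_mat n m"
    and B': "B' \<in> carrier_mat m n" and E: "E \<in> carrier_mat m m"
  shows "det (four_block_mat A B B' E) \<le> det A * det E"
proof -
  let ?M = "four_block_mat A B B' E"
  have M: "?M \<in> carrier_mat (n + m) (n + m)"
    using A E by (rule four_block_carrier_mat)
  obtain U where U: "U \<in> carrier_mat n n" "det U = 1" "diagonal_mat (U * A * mat_adjoint U)"
    using positive_mat_unimodular_diagonalization[OF A positive_mat_four_block(1)[OF assms]] .
  obtain V where V: "V \<in> carrier_mat m m" "det V = 1" "diagonal_mat (V * E * mat_adjoint V)"
    using positive_mat_unimodular_diagonalization[OF E positive_mat_four_block(2)[OF assms]] .
  have cU: "U * A * mat_adjoint U \<in> carrier_mat n n" and cV: "V * E * mat_adjoint V \<in> carrier_mat m m"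
    using congruence_carrier[OF A U(1)] congruence_carrier[OF E V(1)] by simp_all
  define F where "F = four_block_mat U (0\<^sub>m n m) (0\<^sub>m m n) V"
  note cF = congruence_four_block[OF A B B' E U(1) V(1), folded F_def]
  have detF: "det F = 1" using cF(2) U(2) V(2) by simp
  have "det ?M = det (F * ?M * mat_adjoint F)"
    using det_unimodular_congruence[OF M cF(1) detF] by simp
  also have "\<dots> \<le> prod_list (diag_mat (F * ?M * mat_adjoint F))"
    using positive_mat_congruence[OF pos M cF(1)] detF
    by (intro Hadamard_inequality[OF congruence_carrier[OF M cF(1)]]) simp
  also have "\<dots> = det (U * A * mat_adjoint U) * det (V * E * mat_adjoint V)"
    unfolding cF(3) diag_four_block_mat[OF cU cV]
    using det_diagonal_mat[OF cU U(3)] det_diagonal_mat[OF cV V(3)] by simp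
  also have "\<dots> = det A * det E"
    using det_unimodular_congruence[OF A U(1,2)] det_unimodular_congruence[OF E V(1,2)] by simp
  finally show ?thesis .
qed


section \<open>The determinant of a block-diagonal perturbation of the identity\<close>

text \<open>
  \<open>P D\<close> need not be self-adjoint, so the positivity of \<open>1 + P D\<close> is not available; but it factors as
  \<open>(D\<^sup>-\<^sup>1 + P) D\<close>, and both factors are positive matrices.
\<close>

lemma det_one_plus_pos:
  assumes P: "P \<in> carrier_mat n n" "positive_mat P" and D: "D \<in> carrier_mat n n" "positive_mat D"
  shows "0 < det (1\<^sub>m n + P * D)"
proof -
  define D' where "D' = the (mat_inverse D)"
  have D': "D' \<in> carrier_mat n n" "D * D' = 1\<^sub>m n" "D' * D = 1\<^sub>m n"
    using positive_mat_inverse[OF D] by (simp_all add: D'_def)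
  have "positive_mat (D' + P)"
    using positive_mat_add[OF positive_mat_right_inverse[OF D(2,1) D'(1,2)] P(2) D'(1) P(1)] .
  then have "0 < det (D' + P)"
    using positive_mat_det_pos[of "D' + P" n] D'(1) P(1) by simp
  moreover have "1\<^sub>m n + P * D = (D' + P) * D"
    using add_mult_distrib_mat[OF D'(1) P(1) D(1)] D'(3) by simp
  ultimately show ?thesis
    using det_mult[of "D' + P" n D] D'(1) P(1) D(1) positive_mat_det_pos[OF D]
    by (simp add: complex_mult_pos)
qed

text \<open>
  Fischer's inequality for the sum of \<open>diag(D, E)\<^sup>-\<^sup>1\<close> and the block matrix, multiplied by \<open>det D \<cdot> det E\<close>.
  The diagonal blocks of that sum are \<open>D\<^sup>-\<^sup>1 + P\<close> and \<open>E\<^sup>-\<^sup>1 + Q\<close>.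
\<close>

lemma det_one_plus_four_block_le:
  assumes pos: "positive_mat (four_block_mat P B B' Q)"
    and P: "P \<in> carrier_mat n n" and B: "B \<in> carrier_mat n m"
    and B': "B' \<in> carrier_mat m n" and Q: "Q \<in> carrier_mat m m"
    and D: "D \<in> carrier_mat n n" "positive_mat D" and E: "E \<in> carrier_mat m m" "positive_mat E"
  shows "det (1\<^sub>m (n + m) + four_block_mat P B B' Q * four_block_mat D (0\<^sub>m n m) (0\<^sub>m m n) E)
    \<le> det (1\<^sub>m n + P * D) * det (1\<^sub>m m + Q * E)"
proof -
  let ?P = "four_block_mat P B B' Q" and ?D = "four_block_mat D (0\<^sub>m n m) (0\<^sub>m m n) E"
  define D' E' where "D' = the (mat_inverse D)" and "E' = the (mat_inverse E)"
  have D': "D' \<in> carrier_mat n n" "D * D' = 1\<^sub>m n" "D' * D = 1\<^sub>m n"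
    using positive_mat_inverse[OF D] by (simp_all add: D'_def)
  have E': "E' \<in> carrier_mat m m" "E * E' = 1\<^sub>m m" "E' * E = 1\<^sub>m m"
    using positive_mat_inverse[OF E] by (simp_all add: E'_def)
  let ?D' = "four_block_mat D' (0\<^sub>m n m) (0\<^sub>m m n) E'"
  have c: "?P \<in> carrier_mat (n + m) (n + m)" "?D \<in> carrier_mat (n + m) (n + m)"
    "?D' \<in> carrier_mat (n + m) (n + m)"
    using P Q D E D' E' by (simp_all only: four_block_carrier_mat)
  have D'P: "D' + P \<in> carrier_mat n n" and E'Q: "E' + Q \<in> carrier_mat m m"
    using D'(1) E'(1) P Q by simp_all
  have sum: "?D' + ?P = four_block_mat (D' + P) B B' (E' + Q)"
    using add_four_block_mat[OF D'(1) zero_carrier_mat zero_carrier_mat E'(1) P B B' Q] B B' by simp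
  have "?D' * ?D = 1\<^sub>m (n + m)"
    using mult_four_block_mat[OF D'(1) zero_carrier_mat zero_carrier_mat E'(1) D(1)
        zero_carrier_mat zero_carrier_mat E(1)] D(1) E(1) D' E' by simp
  then have "1\<^sub>m (n + m) + ?P * ?D = (?D' + ?P) * ?D"
    using add_mult_distrib_mat[OF c(3,1,2)] by simp
  then have "det (1\<^sub>m (n + m) + ?P * ?D) = det (?D' + ?P) * (det D * det E)"
    using det_mult[of "?D' + ?P" "n + m" ?D] c
      det_four_block_mat_upper_right_zero[OF D(1) refl zero_carrier_mat E(1)] by simp
  also have "\<dots> \<le> det (D' + P) * det (E' + Q) * (det D * det E)"
  proof (rule mult_right_mono)
    have "positive_mat ?D'"
      using positive_mat_four_block_diag[OF D'(1) positive_mat_right_inverse[OF D(2,1) D'(1,2)]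
          E'(1) positive_mat_right_inverse[OF E(2,1) E'(1,2)]] .
    then have "positive_mat (four_block_mat (D' + P) B B' (E' + Q))"
      using positive_mat_add[OF _ pos c(3,1)] sum by simp
    then show "det (?D' + ?P) \<le> det (D' + P) * det (E' + Q)"
      unfolding sum using Fischer_inequality D'P B B' E'Q by blast
    show "0 \<le> det D * det E"
      using positive_mat_det_pos[OF D] positive_mat_det_pos[OF E] by (simp add: less_imp_le)
  qed
  also have "\<dots> = det ((D' + P) * D) * det ((E' + Q) * E)"
    using det_mult[OF D'P D(1)] det_mult[OF E'Q E(1)] by simp
  also have "\<dots> = det (1\<^sub>m n + P * D) * det (1\<^sub>m m + Q * E)"
    using add_mult_distrib_mat[OF D'(1) P D(1)] add_mult_distrib_mat[OF E'(1) Q E(1)] D'(3) E'(3)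
    by simp
  finally show ?thesis .
qed

text \<open>
  The factorization \<open>C + D = C (1 + P D)\<close> is used twice: for the large matrix and for every block.
\<close>

lemma det_add_over_det:
  fixes C P D :: "complex mat"
  assumes "C \<in> carrier_mat n n" "P \<in> carrier_mat n n" "C * P = 1\<^sub>m n" "D \<in> carrier_mat n n"
  shows "det (C + D) / det C = det (1\<^sub>m n + P * D)"
proof -
  have "det C * det P = 1"
    using det_mult[OF assms(1,2)] assms(3) by simp
  then have "det C \<noteq> 0" by auto
  have PD: "P * D \<in> carrier_mat n n" using assms by simp
  have "C + D = C * (1\<^sub>m n + P * D)"
    using mult_add_distrib_mat[OF assms(1) one_carrier_mat PD] assoc_mult_mat[OF assms(1,2,4)] assms
    by simp
  then have "det (C + D) = det C * det (1\<^sub>m n + P * D)"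
    using det_mult[of C n "1\<^sub>m n + P * D"] assms(1) PD by simp
  then show ?thesis using \<open>det C \<noteq> 0\<close> by simp
qed

text \<open>
  The recursion of \<open>diag_block_mat\<close> removes the first block.  In the induction on \<open>k\<close> the last one has
  to be removed, so that the positions of the other blocks do not change.
\<close>

lemma diag_block_mat_upt_Suc:
  assumes "diag_block_mat (map Ds [1..<Suc k]) \<in> carrier_mat s s" "Ds (Suc k) \<in> carrier_mat m m"
  shows "diag_block_mat (map Ds [1..<Suc (Suc k)])
    = four_block_mat (diag_block_mat (map Ds [1..<Suc k])) (0\<^sub>m s m) (0\<^sub>m m s) (Ds (Suc k))"
proof -
  have "map Ds [1..<Suc (Suc k)] = map Ds [1..<Suc k] @ [Ds (Suc k)]" by simp
  then show ?thesis
    using assms by (simp only: diag_block_mat_last Let_def carrier_matD)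
qed

lemma positive_mat_diag_block_mat:
  assumes "\<And>i. i \<in> {1..k} \<Longrightarrow> Ds i \<in> carrier_mat (n i) (n i)"
    and "\<And>i. i \<in> {1..k} \<Longrightarrow> positive_mat (Ds i)"
  shows "diag_block_mat (map Ds [1..<Suc k]) \<in> carrier_mat (\<Sum>i = 1..k. n i) (\<Sum>i = 1..k. n i) \<and>
    positive_mat (diag_block_mat (map Ds [1..<Suc k]))"
  using assms
proof (induction k)
  case 0
  then show ?case
    by (auto simp: positive_mat_def intro!: eq_matI)
next
  case (Suc k)
  let ?s = "\<Sum>i = 1..k. n i"
  have IH: "diag_block_mat (map Ds [1..<Suc k]) \<in> carrier_mat ?s ?s"
    "positive_mat (diag_block_mat (map Ds [1..<Suc k]))"
    using Suc by simp_all
  have D: "Ds (Suc k) \<in> carrier_mat (n (Suc k)) (n (Suc k))" "positive_mat (Ds (Suc k))"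
    using Suc.prems by simp_all
  show ?case
    unfolding diag_block_mat_upt_Suc[OF IH(1) D(1)]
    using four_block_carrier_mat[OF IH(1) D(1)] positive_mat_four_block_diag[OF IH D] by simp
qed

lemma diagonal_block_four_block:
  assumes "A \<in> carrier_mat (\<Sum>j = 1..k. n j) (\<Sum>j = 1..k. n j)"
    and "E \<in> carrier_mat (n (Suc k)) (n (Suc k))"
  shows "i \<in> {1..k} \<Longrightarrow> diagonal_block n i (four_block_mat A B C E) = diagonal_block n i A"
    and "diagonal_block n (Suc k) (four_block_mat A B C E) = E"
proof -
  show "diagonal_block n i (four_block_mat A B C E) = diagonal_block n i A" if i: "i \<in> {1..k}"
  proof -
    have "(\<Sum>j = 1..<i. n j) + n i = (\<Sum>j = 1..<Suc i. n j)"
      using i by simp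
    also have "\<dots> \<le> (\<Sum>j = 1..k. n j)"
      using i by (intro sum_mono2) auto
    finally have lt: "(\<Sum>j = 1..<i. n j) + r < (\<Sum>j = 1..k. n j)" if "r < n i" for r
      using that by simp
    show ?thesis
      using assms lt trans_less_add1[OF lt]
      unfolding diagonal_block_def Let_def by (intro eq_matI) auto
  qed
  have "(\<Sum>j = 1..<Suc k. n j) = (\<Sum>j = 1..k. n j)"
    by (simp add: atLeastLessThanSuc_atLeastAtMost)
  then show "diagonal_block n (Suc k) (four_block_mat A B C E) = E"
    using assms unfolding diagonal_block_def Let_def by (intro eq_matI) auto
qed

lemma det_one_plus_diag_block_le:
  assumes "\<And>i. i \<in> {1..k} \<Longrightarrow> Ds i \<in> carrier_mat (n i) (n i)"
    and "\<And>i. i \<in> {1..k} \<Longrightarrow> positive_mat (Ds i)"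
    and "P \<in> carrier_mat (\<Sum>i = 1..k. n i) (\<Sum>i = 1..k. n i)" "positive_mat P"
  shows "det (1\<^sub>m (\<Sum>i = 1..k. n i) + P * diag_block_mat (map Ds [1..<Suc k]))
    \<le> (\<Prod>i = 1..k. det (1\<^sub>m (n i) + diagonal_block n i P * Ds i))"
  using assms
proof (induction k arbitrary: P)
  case 0
  then show ?case by (simp add: det_dim_zero)
next
  case (Suc k)
  let ?s = "\<Sum>i = 1..k. n i" and ?m = "n (Suc k)" and ?D = "diag_block_mat (map Ds [1..<Suc k])"
  have s: "(\<Sum>i = 1..Suc k. n i) = ?s + ?m" by simp
  have P: "P \<in> carrier_mat (?s + ?m) (?s + ?m)"
    using Suc.prems(3) by (simp only: s)
  obtain A B C E where bl: "A \<in> carrier_mat ?s ?s" "B \<in> carrier_mat ?s ?m" "C \<in> carrier_mat ?m ?s"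
    "E \<in> carrier_mat ?m ?m" "P = four_block_mat A B C E"
    using mat_four_block_cases[OF P] .
  have pos: "positive_mat (four_block_mat A B C E)" using Suc.prems(4) bl(5) by simp
  note posAE = positive_mat_four_block(1,2)[OF pos bl(1-4)]
  have D: "?D \<in> carrier_mat ?s ?s" "positive_mat ?D"
    using positive_mat_diag_block_mat[of k Ds n] Suc.prems(1,2) by simp_all
  have E: "Ds (Suc k) \<in> carrier_mat ?m ?m" "positive_mat (Ds (Suc k))"
    using Suc.prems(1,2) by simp_all
  have "det (1\<^sub>m (\<Sum>i = 1..Suc k. n i) + P * diag_block_mat (map Ds [1..<Suc (Suc k)]))
      \<le> det (1\<^sub>m ?s + A * ?D) * det (1\<^sub>m ?m + E * Ds (Suc k))"
    unfolding s diag_block_mat_upt_Suc[OF D(1) E(1)] bl(5)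
    by (rule det_one_plus_four_block_le[OF pos bl(1-4) D E])
  also have "\<dots> \<le> (\<Prod>i = 1..k. det (1\<^sub>m (n i) + diagonal_block n i A * Ds i))
      * det (1\<^sub>m ?m + E * Ds (Suc k))"
  proof (rule mult_right_mono)
    show "det (1\<^sub>m ?s + A * ?D) \<le> (\<Prod>i = 1..k. det (1\<^sub>m (n i) + diagonal_block n i A * Ds i))"
      using Suc.prems(1,2) by (intro Suc.IH[OF _ _ bl(1) posAE(1)]) simp_all
    show "0 \<le> det (1\<^sub>m ?m + E * Ds (Suc k))"
      using det_one_plus_pos[OF bl(4) posAE(2) E] by (rule less_imp_le)
  qed
  also have "\<dots> = (\<Prod>i = 1..Suc k. det (1\<^sub>m (n i) + diagonal_block n i P * Ds i))"
    using diagonal_block_four_block[OF bl(1,4), where B = B and C = C] bl(5) by simp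
  finally show ?case .
qed

theorem theorem1p2:
  fixes k :: nat and n :: "nat \<Rightarrow> nat"
    and Cs Ds :: "nat \<Rightarrow> complex mat" and C :: "complex mat"
  assumes "\<And>i. i \<in> {1..k} \<Longrightarrow> 0 < n i"
    and "\<And>i. i \<in> {1..k} \<Longrightarrow> Cs i \<in> carrier_mat (n i) (n i)"
    and "\<And>i. i \<in> {1..k} \<Longrightarrow> positive_mat (Cs i)"
    and "\<And>i. i \<in> {1..k} \<Longrightarrow> Ds i \<in> carrier_mat (n i) (n i)"
    and "\<And>i. i \<in> {1..k} \<Longrightarrow> positive_mat (Ds i)"
    and "C \<in> carrier_mat (\<Sum>i = 1..k. n i) (\<Sum>i = 1..k. n i)"
    and "positive_mat C"
    and "\<And>i. i \<in> {1..k} \<Longrightarrow>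
           diagonal_block n i (the (mat_inverse C)) = the (mat_inverse (Cs i))"
  shows "det (C + diag_block_mat (map Ds [1..<Suc k])) / det C
           \<le> (\<Prod>i = 1..k. det (Cs i + Ds i) / det (Cs i))"
proof -
  let ?N = "\<Sum>i = 1..k. n i" and ?D = "diag_block_mat (map Ds [1..<Suc k])"
  define P where "P = the (mat_inverse C)"
  have P: "P \<in> carrier_mat ?N ?N" "C * P = 1\<^sub>m ?N"
    using positive_mat_inverse[OF assms(6,7)] by (simp_all add: P_def)
  have D: "?D \<in> carrier_mat ?N ?N"
    using positive_mat_diag_block_mat[of k Ds n] assms(4,5) by simp
  have "det (C + ?D) / det C = det (1\<^sub>m ?N + P * ?D)"
    by (rule det_add_over_det[OF assms(6) P D])
  also have "\<dots> \<le> (\<Prod>i = 1..k. det (1\<^sub>m (n i) + diagonal_block n i P * Ds i))"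
    by (rule det_one_plus_diag_block_le[OF assms(4,5) P(1)
          positive_mat_right_inverse[OF assms(7,6) P]])
  also have "\<dots> = (\<Prod>i = 1..k. det (Cs i + Ds i) / det (Cs i))"
  proof (rule prod.cong[OF refl])
    fix i assume i: "i \<in> {1..k}"
    show "det (1\<^sub>m (n i) + diagonal_block n i P * Ds i) = det (Cs i + Ds i) / det (Cs i)"
      unfolding P_def assms(8)[OF i]
      using det_add_over_det[OF assms(2)[OF i] positive_mat_inverse(1,2)[OF assms(2,3)[OF i]]
          assms(4)[OF i]] by simp
  qed
  finally show ?thesis .
qed

end
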